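(* Let $v\in S_n$ and let $A$ and $B$ be two minors in $Z^{(v)}$ of sizes $p$ and $q$ respectively, with $p\le q$, such that $A$ is a subminor of $B$. Let $m_A$ denote a monomial in $\det A$, and similarly let $m_B$ be a monomial in $\det B$. Then there exists $m_A$ such that $m_A\mid m_B$ if and only if there exists a path in $A$ that is a subpath of $m_B$.
   Context: Rows of $n\times n$ matrices are numbered from bottom to top and columns from left to right. For $v\in S_n$, $Z^{(v)}$ is the $n\times n$ matrix whose entry in row $i$ (from the bottom) and column $j$ is: $1$ if $i=n-v(j)+1$; $0$ if $i>n-v(j)+1$; $0$ if $i=n-v(j')+1$ for some $j'<j$; and an indeterminate $z_{ij}$ otherwise. A minor of $Z^{(v)}$ means a square submatrix, formed by some rows and the same number of columns of $Z^{(v)}$. $A$ is a subminor of $B$ if every row and every column of $Z^{(v)}$ used by $A$ is also used by $B$. A path in a $q\times q$ matrix $[x_{ij}]$ is a set of entries (positions) $\{x_{i_11},\dots,x_{i_qq}\}$, one from each column, with $i_1,\dots,i_q$ all distinct; a subpath of a path is a subcollection of its points. A monomial in $\det A$ is a nonzero term in the expansion of $\det A$, considered up to sign; it is the product of the entries of a path in $A$ having no zero entry, and is identified with that path.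
   Formalization: Divisibility of m_A into m_B is read with a separate symbol for every position, so entries 1 on a path still count; for products of the actual entries the claim fails (n=3, v=id: A=[1] at (2,2), m_B=z_21 z_12). *)

theory Defs
  imports Main "HOL-Library.Poly_Mapping" "HOL-Combinatorics.Permutations"
begin

text \<open>
  A position is a pair \<open>(i, j)\<close>: row \<open>i\<close>, counted from the bottom, and column \<open>j\<close>, counted from
  the left, both starting at 1.  Polynomials in the indeterminates \<open>z\<^sub>i\<^sub>j\<close> are finitely supported
  functions from exponent vectors to coefficients.
\<close>

type_synonym position = "nat \<times> nat"
type_synonym 'k mpoly = "(position \<Rightarrow>\<^sub>0 nat) \<Rightarrow>\<^sub>0 'k"

definition indet :: "nat \<Rightarrow> nat \<Rightarrow> 'k::comm_ring_1 mpoly" where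
  "indet i j = Poly_Mapping.single (Poly_Mapping.single (i, j) 1) 1"

definition Zmat :: "nat \<Rightarrow> (nat \<Rightarrow> nat) \<Rightarrow> nat \<Rightarrow> nat \<Rightarrow> 'k::comm_ring_1 mpoly" where
  "Zmat n v i j =
    (if i = n - v j + 1 then 1
     else if i > n - v j + 1 then 0
     else if \<exists>j'\<in>{1..<j}. i = n - v j' + 1 then 0
     else indet i j)"

definition is_minor :: "nat \<Rightarrow> nat \<Rightarrow> nat set \<Rightarrow> nat set \<Rightarrow> bool" where
  "is_minor n p R C \<longleftrightarrow> R \<subseteq> {1..n} \<and> C \<subseteq> {1..n} \<and> card R = p \<and> card C = p"

definition subminor :: "nat set \<Rightarrow> nat set \<Rightarrow> nat set \<Rightarrow> nat set \<Rightarrow> bool" where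
  "subminor R C R' C' \<longleftrightarrow> R \<subseteq> R' \<and> C \<subseteq> C'"

definition is_path :: "nat set \<Rightarrow> nat set \<Rightarrow> position set \<Rightarrow> bool" where
  "is_path R C P \<longleftrightarrow> P \<subseteq> R \<times> C \<and> (\<forall>j\<in>C. \<exists>!i. (i, j) \<in> P) \<and> inj_on fst P"

definition path_prod :: "(nat \<Rightarrow> nat \<Rightarrow> 'a::comm_monoid_mult) \<Rightarrow> position set \<Rightarrow> 'a" where
  "path_prod M P = (\<Prod>(i, j)\<in>P. M i j)"

definition det_monomial ::
    "(nat \<Rightarrow> nat \<Rightarrow> 'a::zero) \<Rightarrow> nat set \<Rightarrow> nat set \<Rightarrow> position set \<Rightarrow> bool" where
  "det_monomial M R C P \<longleftrightarrow> is_path R C P \<and> (\<forall>(i, j)\<in>P. M i j \<noteq> 0)"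

text \<open>
  A monomial of a determinant is identified with its path, so it remembers the positions at which
  the entry 1 was used.  Divisibility of monomials therefore has to be read with one symbol per
  position: it is divisibility, in the polynomial ring, of \<open>path_prod indet P\<close>, the product
  \<open>x\<^sub>i\<^sub>1\<^sub>1 \<cdots> x\<^sub>i\<^sub>q\<^sub>q\<close> of the entries of the generic matrix along the path.
\<close>

text \<open>
  For a nonzero path without entries equal to 1, the generic product is the product of the entries
  of the matrix itself.
\<close>

lemma path_prod_Zmat_eq_indet:
  assumes "\<And>i j. (i, j) \<in> P \<Longrightarrow> Zmat n v i j \<notin> {0, 1 :: 'k::comm_ring_1 mpoly}"
  shows "path_prod (Zmat n v) P = (path_prod indet P :: 'k mpoly)"
  unfolding path_prod_def
proof (rule prod.cong[OF refl], clarify)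
  fix i j assume "(i, j) \<in> P"
  with assms[of i j] show "Zmat n v i j = (indet i j :: 'k mpoly)"
    by (auto simp: Zmat_def split: if_splits)
qed

text \<open>
  Divisibility of the products of the actual entries of the matrix is weaker when entries 1 occur:
  for \<open>n = 3\<close> and \<open>v = id\<close>, the monomial 1 of the size-one minor at \<open>(2, 2)\<close> divides
  \<open>z\<^sub>2\<^sub>1 z\<^sub>1\<^sub>2\<close>, but \<open>(2, 2)\<close> does not lie on the corresponding path.
\<close>

lemma substituted_divisibility_too_weak:
  defines "Z \<equiv> (Zmat 3 id :: nat \<Rightarrow> nat \<Rightarrow> 'k::comm_ring_1 mpoly)"
  defines "Q \<equiv> {(2, 1), (1, 2)} :: position set"
  shows "is_minor 3 1 {2} {2}" and "is_minor 3 2 {1, 2} {1, 2}"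
    and "subminor {2} {2} {1, 2} {1, 2}"
    and "det_monomial Z {2} {2} {(2, 2)}" and "det_monomial Z {1, 2} {1, 2} Q"
    and "path_prod Z {(2, 2)} dvd path_prod Z Q"
    and "\<not> (\<exists>P. is_path {2} {2} P \<and> P \<subseteq> Q)"
proof -
  have nz: "indet i j \<noteq> (0 :: 'k mpoly)" for i j
    by (auto simp: indet_def dest: arg_cong[where f = Poly_Mapping.keys])
  have Z: "Z 2 2 = 1" "Z 2 1 = indet 2 1" "Z 1 2 = indet 1 2"
    by (auto simp: Z_def Zmat_def)
  show "is_minor 3 1 {2} {2}" "is_minor 3 2 {1, 2} {1, 2}" "subminor {2} {2} {1, 2} {1, 2}"
    by (auto simp: is_minor_def subminor_def)
  show "det_monomial Z {2} {2} {(2, 2)}"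
    by (auto simp: det_monomial_def is_path_def Z)
  show "det_monomial Z {1, 2} {1, 2} Q"
    using Z(2,3) nz by (auto simp: det_monomial_def is_path_def Q_def inj_on_def)
  show "path_prod Z {(2, 2)} dvd path_prod Z Q"
    by (simp add: path_prod_def Z)
  show "\<not> (\<exists>P. is_path {2} {2} P \<and> P \<subseteq> Q)"
    by (fastforce simp: is_path_def Q_def)
qed

end

theory Submission
  imports Defs
begin

text \<open>
  Since every position carries its own indeterminate, the generic product along a finite set of
  positions is a single monomial with coefficient 1, whose exponent vector is the indicator function
  of the set.  Such a monomial divides another one exactly when the first set is contained in the
  second (\<open>path_prod_indet_dvd_iff\<close>): all terms of a multiple of \<open>x\<^sup>a\<close> have exponents of the form
  \<open>a + c\<close>, whatever the coefficient ring.  So \<open>m\<^sub>A\<close> divides \<open>m\<^sub>B\<close> exactly when \<open>m\<^sub>A\<close> is a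
  subpath of \<open>m\<^sub>B\<close>.  Nonvanishing is no extra condition on subpaths: a subpath of the nonzero path
  \<open>m\<^sub>B\<close> meets only nonzero entries of \<open>Z\<close>, so a path in \<open>A\<close> lying on \<open>m\<^sub>B\<close> is already a
  monomial of the determinant of \<open>A\<close>.
\<close>

lemma path_prod_indet_eq_single:
  "path_prod indet P =
     (Poly_Mapping.single (\<Sum>x\<in>P. Poly_Mapping.single x 1) 1 :: 'k::comm_ring_1 mpoly)"
  unfolding path_prod_def
  by (induction P rule: infinite_finite_induct)
     (auto simp: indet_def Poly_Mapping.mult_single split: prod.splits)

lemma lookup_sum_single_one:
  assumes "finite P"
  shows "Poly_Mapping.lookup (\<Sum>x\<in>P. Poly_Mapping.single x (1::nat)) y = (if y \<in> P then 1 else 0)"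
  using assms by (simp add: Poly_Mapping.lookup_sum lookup_single when_def)

text \<open>
  The support of a product lies in the sum of the supports, also when the coefficients have zero
  divisors.  Hence \<open>b\<close>, an exponent of the multiple, is \<open>a\<close> plus an exponent of the cofactor.
\<close>

lemma single_one_dvd_single_oneD:
  fixes a b :: "'a::comm_monoid_add"
  assumes "(Poly_Mapping.single a 1 :: 'a \<Rightarrow>\<^sub>0 'k::comm_semiring_1) dvd Poly_Mapping.single b 1"
  shows "\<exists>c. b = a + c"
proof -
  obtain f where f: "Poly_Mapping.single b 1 = (Poly_Mapping.single a 1 :: 'a \<Rightarrow>\<^sub>0 'k) * f"
    using assms by (elim dvdE)
  have "b \<in> Poly_Mapping.keys (Poly_Mapping.single b (1::'k))"
    by simp
  then have "b \<in> {a' + c |a' c. a' \<in> Poly_Mapping.keys (Poly_Mapping.single a (1::'k)) \<and>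
                                 c \<in> Poly_Mapping.keys f}"
    unfolding f using keys_mult by blast
  then show ?thesis
    by auto
qed

lemma path_prod_indet_dvd_iff:
  assumes "finite P" "finite Q"
  shows "(path_prod indet P :: 'k::comm_ring_1 mpoly) dvd path_prod indet Q \<longleftrightarrow> P \<subseteq> Q"
proof
  assume "P \<subseteq> Q"
  then show "(path_prod indet P :: 'k mpoly) dvd path_prod indet Q"
    unfolding path_prod_def using assms(2) by (intro prod_dvd_prod_subset)
next
  assume "(path_prod indet P :: 'k mpoly) dvd path_prod indet Q"
  then obtain c where c: "(\<Sum>x\<in>Q. Poly_Mapping.single x (1::nat)) =
      (\<Sum>x\<in>P. Poly_Mapping.single x 1) + c"
    unfolding path_prod_indet_eq_single by (blast dest: single_one_dvd_single_oneD)
  show "P \<subseteq> Q"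
  proof
    fix y assume "y \<in> P"
    with arg_cong[OF c, of "\<lambda>e. Poly_Mapping.lookup e y"] show "y \<in> Q"
      using assms by (simp add: lookup_sum_single_one lookup_add del: One_nat_def split: if_splits)
  qed
qed

lemma is_path_finite:
  assumes "is_minor n p R C" "is_path R C P"
  shows "finite P"
proof -
  have "finite (R \<times> C)"
    using assms(1) by (auto simp: is_minor_def intro: finite_subset)
  then show ?thesis
    using assms(2) by (auto simp: is_path_def intro: finite_subset)
qed

lemma det_monomial_subpath:
  assumes "det_monomial M R' C' Q" "is_path R C P" "P \<subseteq> Q"
  shows "det_monomial M R C P"
  using assms by (auto simp: det_monomial_def)

theorem theorem6p1p2:
  fixes n p q :: nat and v :: "nat \<Rightarrow> nat"
    and R\<^sub>A C\<^sub>A R\<^sub>B C\<^sub>B :: "nat set" and m\<^sub>B :: "position set"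
    and Z :: "nat \<Rightarrow> nat \<Rightarrow> 'k::comm_ring_1 mpoly"
  assumes "v permutes {1..n}"
    and "Z = Zmat n v"
    and "is_minor n p R\<^sub>A C\<^sub>A" and "is_minor n q R\<^sub>B C\<^sub>B" and "p \<le> q"
    and "subminor R\<^sub>A C\<^sub>A R\<^sub>B C\<^sub>B"
    and "det_monomial Z R\<^sub>B C\<^sub>B m\<^sub>B"
  shows "(\<exists>m\<^sub>A. det_monomial Z R\<^sub>A C\<^sub>A m\<^sub>A \<and> (path_prod indet m\<^sub>A :: 'k mpoly) dvd path_prod indet m\<^sub>B)
     \<longleftrightarrow> (\<exists>P. is_path R\<^sub>A C\<^sub>A P \<and> P \<subseteq> m\<^sub>B)"
proof -
  have fin_B: "finite m\<^sub>B"
    using assms(4,7) by (auto simp: det_monomial_def intro: is_path_finite)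
  have dvd_iff: "(path_prod indet P :: 'k mpoly) dvd path_prod indet m\<^sub>B \<longleftrightarrow> P \<subseteq> m\<^sub>B"
    if "is_path R\<^sub>A C\<^sub>A P" for P
    using is_path_finite[OF assms(3) that] fin_B by (rule path_prod_indet_dvd_iff)
  have "det_monomial Z R\<^sub>A C\<^sub>A P \<and> (path_prod indet P :: 'k mpoly) dvd path_prod indet m\<^sub>B
      \<longleftrightarrow> is_path R\<^sub>A C\<^sub>A P \<and> P \<subseteq> m\<^sub>B" for P
    using dvd_iff[of P] det_monomial_subpath[OF assms(7), of R\<^sub>A C\<^sub>A P]
    by (auto simp: det_monomial_def)
  then show ?thesis
    by simp
qed

end
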